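(* Let $n\ge 2$, $L\ge 1$ be integers and let $c>0$ be real. Let $\Phi_1,\dots,\Phi_L$ be the clauses (arbitrary rank-one projectors, each on two qubits) of a NO instance of Quantum 2-SAT on $n$ qubits with promise gap $c$, i.e. the smallest eigenvalue of $H=\sum_{\alpha=1}^L\Phi_\alpha$ is at least $c$. Put $$f=\max\left\{\frac{7}{c},1\right\},\qquad T=\frac{f^2L^2n^2}{2},\qquad N=T\left(\frac{fL-1}{fL}\right)^3-fLn,$$ and assume that $T$ is an integer. If the Quantum Algorithm is run on these clauses for $T$ steps, then with probability at most $1/3$ more than $N$ of the $T$ measurement outcomes have value $0$.
   Context: Setting. There are $n$ qubits. A clause is a rank-one orthogonal projector $\Phi_\alpha=|\phi_\alpha\rangle\langle\phi_\alpha|$ ($|\phi_\alpha\rangle$ a unit vector in the space of two distinct qubits $i,j$ depending on $\alpha$), acting as the identity on all other qubits. In a NO instance with promise gap $c>0$, $\mathrm{tr}[H\rho]\ge c$ for every $n$-qubit density operator $\rho$, where $H=\sum_{\alpha=1}^L\Phi_\alpha$. No further restriction is placed on the clauses of a NO instance. Quantum Algorithm, run for $T$ steps. The initial state is the maximally mixed state $\mathbb{1}/2^n$. At each step, choose $\alpha\in\{1,\dots,L\}$ uniformly at random (independently of the past) and perform the projective measurement $\{\Phi_\alpha,\mathbb{1}-\Phi_\alpha\}$ on the current state $\rho$. Outcome $1$ occurs with probability $\mathrm{tr}[\Phi_\alpha\rho]$, and the post-measurement state is $\Phi_\alpha\rho\Phi_\alpha/\mathrm{tr}[\Phi_\alpha\rho]$;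 then one of the two qubits in the support of $\Phi_\alpha$ is chosen uniformly at random and a Haar-random unitary is applied to it (on average, applying to qubit $i$ the map $\Lambda_i(\rho)=\frac{\mathbb{1}_i}{2}\otimes\mathrm{tr}_i[\rho]$). Outcome $0$ occurs with probability $1-\mathrm{tr}[\Phi_\alpha\rho]$, and the state becomes $(\mathbb{1}-\Phi_\alpha)\rho(\mathbb{1}-\Phi_\alpha)/(1-\mathrm{tr}[\Phi_\alpha\rho])$. Each step thus yields one measurement outcome in $\{0,1\}$. *)

theory Defs
  imports "HOL-Probability.Probability"
begin

text \<open>
  The qubits are the elements of a finite type \<open>'q\<close>; a computational basis state assigns a bit to
  every qubit, so the state space of \<open>n = CARD('q)\<close> qubits is \<open>complex ^ ('q \<Rightarrow> bool)\<close>, of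
  dimension \<open>2 ^ n\<close>.
\<close>

type_synonym 'q op = "complex ^ ('q \<Rightarrow> bool) ^ ('q \<Rightarrow> bool)"

definition dagger :: "complex ^ 'm ^ 'k \<Rightarrow> complex ^ 'k ^ 'm" where
  "dagger A = (\<chi> x y. cnj (A $ y $ x))"

definition cinner :: "complex ^ 'k \<Rightarrow> complex ^ 'k \<Rightarrow> complex" where
  "cinner v w = (\<Sum>x\<in>UNIV. cnj (v $ x) * w $ x)"

definition unitary :: "complex ^ 'k ^ 'k \<Rightarrow> bool" where
  "unitary U \<longleftrightarrow> dagger U ** U = mat 1 \<and> U ** dagger U = mat 1"

definition psd :: "complex ^ 'k ^ 'k \<Rightarrow> bool" where
  "psd A \<longleftrightarrow> dagger A = A \<and> (\<forall>v. 0 \<le> Re (cinner v (A *v v)))"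

definition density_op :: "complex ^ 'k ^ 'k \<Rightarrow> bool" where
  "density_op \<rho> \<longleftrightarrow> psd \<rho> \<and> trace \<rho> = 1"

text \<open>A clause consists of its two qubits and the state \<open>\<phi>\<close> in the space of these two qubits.\<close>

datatype 'q clause =
  Clause (qubit1: 'q) (qubit2: 'q) (state: "complex ^ (bool \<times> bool)")

definition valid_clause :: "'q clause \<Rightarrow> bool" where
  "valid_clause C \<longleftrightarrow> qubit1 C \<noteq> qubit2 C \<and> norm (state C) = 1"

text \<open>\<open>|\<phi>\<rangle>\<langle>\<phi>|\<close> on the two qubits of the clause, tensored with the identity on all others.\<close>

definition projector :: "'q::finite clause \<Rightarrow> 'q op" where
  "projector C = (\<chi> x y.
     if \<forall>k. k \<noteq> qubit1 C \<and> k \<noteq> qubit2 C \<longrightarrow> x k = y k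
     then state C $ (x (qubit1 C), x (qubit2 C)) * cnj (state C $ (y (qubit1 C), y (qubit2 C)))
     else 0)"

definition hamiltonian :: "nat \<Rightarrow> (nat \<Rightarrow> 'q::finite clause) \<Rightarrow> 'q op" where
  "hamiltonian L C = (\<Sum>\<alpha> = 1..L. projector (C \<alpha>))"

definition no_instance :: "nat \<Rightarrow> (nat \<Rightarrow> 'q::finite clause) \<Rightarrow> real \<Rightarrow> bool" where
  "no_instance L C c \<longleftrightarrow>
     (\<forall>\<alpha>\<in>{1..L}. valid_clause (C \<alpha>)) \<and>
     (\<forall>\<rho>. density_op \<rho> \<longrightarrow> c \<le> Re (trace (hamiltonian L C ** \<rho>)))"

text \<open>The one-qubit operator \<open>U\<close> acting on qubit \<open>q\<close>, tensored with the identity on all others.\<close>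

definition on_qubit :: "'q::finite \<Rightarrow> complex ^ bool ^ bool \<Rightarrow> 'q op" where
  "on_qubit q U = (\<chi> x y. if \<forall>k. k \<noteq> q \<longrightarrow> x k = y k then U $ x q $ y q else 0)"

text \<open>
  On the compact group of unitary matrices, a left-invariant Borel probability measure is unique and
  also right-invariant, so left invariance characterizes the Haar measure. It is regarded here as a
  measure on all matrices that is concentrated on the unitary ones.
\<close>

definition haar_measure :: "(complex ^ 'k ^ 'k) measure \<Rightarrow> bool" where
  "haar_measure \<mu> \<longleftrightarrow>
     prob_space \<mu> \<and> sets \<mu> = sets borel \<and> (AE U in \<mu>. unitary U) \<and>
     (\<forall>V. unitary V \<longrightarrow> distr \<mu> borel (\<lambda>U. V ** U) = \<mu>)"

definition outcome_prob :: "'q::finite op \<Rightarrow> 'q op \<Rightarrow> real" where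
  "outcome_prob P \<rho> = Re (trace (P ** \<rho>))"

definition post_state :: "'q::finite op \<Rightarrow> 'q op \<Rightarrow> 'q op" where
  "post_state P \<rho> = (P ** \<rho> ** P) /\<^sub>R outcome_prob P \<rho>"

text \<open>
  One step of the algorithm: the joint law of the measurement outcome (\<open>True\<close> for 1, \<open>False\<close> for 0)
  and of the next state, given the current state \<open>\<rho>\<close>.
\<close>

definition step ::
    "(complex ^ bool ^ bool) measure \<Rightarrow> nat \<Rightarrow> (nat \<Rightarrow> 'q::finite clause) \<Rightarrow> 'q op
      \<Rightarrow> (bool \<times> 'q op) measure" where
  "step \<mu> L C \<rho> =
     measure_pmf (pmf_of_set {1..L}) \<bind> (\<lambda>\<alpha>.
     measure_pmf (bernoulli_pmf (outcome_prob (projector (C \<alpha>)) \<rho>)) \<bind> (\<lambda>b.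
       if b then
         measure_pmf (pmf_of_set {qubit1 (C \<alpha>), qubit2 (C \<alpha>)}) \<bind> (\<lambda>q.
         distr \<mu> (count_space UNIV \<Otimes>\<^sub>M borel) (\<lambda>U.
           (True, on_qubit q U ** post_state (projector (C \<alpha>)) \<rho> ** dagger (on_qubit q U))))
       else
         return (count_space UNIV \<Otimes>\<^sub>M borel)
           (False, post_state (mat 1 - projector (C \<alpha>)) \<rho>)))"

text \<open>
  The joint law of the list of outcomes, in order, of the first \<open>t\<close> steps and of the state after them.
\<close>

primrec run ::
    "(complex ^ bool ^ bool) measure \<Rightarrow> nat \<Rightarrow> (nat \<Rightarrow> 'q::finite clause) \<Rightarrow> nat
      \<Rightarrow> (bool list \<times> 'q op) measure" where
  "run \<mu> L C 0 = return (count_space UNIV \<Otimes>\<^sub>M borel) ([], mat 1 /\<^sub>R 2 ^ CARD('q))"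
| "run \<mu> L C (Suc t) =
     run \<mu> L C t \<bind> (\<lambda>(bs, \<rho>).
     distr (step \<mu> L C \<rho>) (count_space UNIV \<Otimes>\<^sub>M borel) (\<lambda>(b, \<rho>'). (bs @ [b], \<rho>')))"

text \<open>
  The condition in \<open>no_instance\<close> on all density operators says that the smallest eigenvalue of the
  Hamiltonian is at least \<open>c\<close>.
\<close>

lemma nonpos_of_quadratic:
  fixes a b :: real
  assumes "\<And>t. t > 0 \<Longrightarrow> 0 \<le> - 2 * t * a + t\<^sup>2 * b"
  shows "a \<le> 0"
proof (rule ccontr)
  assume "\<not> a \<le> 0"
  then have a: "a > 0" by simp
  define t where "t = a / (\<bar>b\<bar> + 1)"
  have t: "t > 0" using a by (simp add: t_def)
  have "t * (\<bar>b\<bar> + 1) = a" by (simp add: t_def)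
  moreover have "0 \<le> t * (- 2 * a + t * b)" using assms[OF t] by (simp add: algebra_simps power2_eq_square)
  then have "0 \<le> - 2 * a + t * b" using t by (simp add: zero_le_mult_iff)
  moreover have "t * b \<le> t * (\<bar>b\<bar> + 1)" using t by (intro mult_left_mono) auto
  ultimately show False using a by linarith
qed

lemma dagger_simps:
  "dagger (dagger A) = A"
  "dagger (A + B) = dagger A + dagger B"
  "dagger (A - B) = dagger A - dagger B"
  "dagger (r *\<^sub>R A) = r *\<^sub>R dagger A"
  "dagger (mat 1) = mat 1"
  by (simp_all add: dagger_def vec_eq_iff mat_def)

lemma dagger_mult: "dagger (A ** B) = dagger B ** dagger A"
  by (simp add: dagger_def matrix_matrix_mult_def vec_eq_iff mult.commute)

lemma cinner_dagger: "cinner v (A *v w) = cinner (dagger A *v v) w"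
  unfolding cinner_def matrix_vector_mult_def dagger_def
  by (simp add: sum_distrib_left sum_distrib_right, subst sum.swap, simp add: algebra_simps)

lemma cinner_lin:
  "cinner v (w + w') = cinner v w + cinner v w'"
  "cinner (v + v') w = cinner v w + cinner v' w"
  "cinner v (w - w') = cinner v w - cinner v w'"
  "cinner (v - v') w = cinner v w - cinner v' w"
  "cinner v (r *\<^sub>R w) = r *\<^sub>R cinner v w"
  "cinner (r *\<^sub>R v) w = r *\<^sub>R cinner v w"
  by (simp_all add: cinner_def algebra_simps sum.distrib sum_subtractf scaleR_sum_right)

lemma cnj_cinner: "cnj (cinner v w) = cinner w v"
  by (simp add: cinner_def mult.commute)

lemma cinner_self: "cinner v v = complex_of_real ((norm v)\<^sup>2)"
  unfolding cinner_def norm_vec_def L2_set_def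
  by (simp add: sum_nonneg complex_norm_square mult.commute del: of_real_power)

lemma psd_conj:
  assumes "psd A"
  shows "psd (B ** A ** dagger B)"
proof -
  have "cinner v ((B ** A ** dagger B) *v v) = cinner (dagger B *v v) (A *v (dagger B *v v))" for v
    by (simp add: matrix_vector_mul_assoc[symmetric] cinner_dagger dagger_simps)
  then show ?thesis using assms by (simp add: psd_def dagger_mult dagger_simps matrix_mul_assoc)
qed

lemma psd_kernel:
  fixes A :: "complex^'k::finite^'k"
  assumes "psd A" "Re (cinner w (A *v w)) = 0"
  shows "A *v w = 0"
proof -
  define u where "u = A *v w"
  have h: "dagger A = A" using assms by (simp add: psd_def)
  have 1: "cinner w (A *v u) = cinner u u" by (simp add: cinner_dagger h u_def)
  have "0 \<le> - 2 * t * (norm u)\<^sup>2 + t\<^sup>2 * Re (cinner u (A *v u))" for t :: real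
  proof -
    have "0 \<le> Re (cinner (w - t *\<^sub>R u) (A *v (w - t *\<^sub>R u)))" using assms by (simp add: psd_def)
    moreover have "A *v (t *\<^sub>R u) = t *\<^sub>R (A *v u)" 
      by (simp add: matrix_vector_mult_def vec_eq_iff scaleR_sum_right)
    ultimately show ?thesis using assms(2)
      by (simp add: matrix_vector_mult_diff_distrib cinner_lin 1 u_def[symmetric] cinner_self power2_eq_square algebra_simps)
  qed
  from nonpos_of_quadratic[OF this] show ?thesis by (simp add: u_def)
qed

lemma mult_axis: "A *v axis y b = (\<chi> x. A $ x $ y * b)"
  by (simp add: matrix_vector_mult_def axis_def vec_eq_iff if_distrib cong: if_cong)

lemma cinner_axis: "cinner (axis x a) v = cnj a * v $ x"
  by (simp add: cinner_def axis_def if_distrib if_distribR cong: if_cong)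

lemma psd_diag: "psd A \<Longrightarrow> A $ x $ x = complex_of_real (Re (A $ x $ x)) \<and> 0 \<le> Re (A $ x $ x)"
proof -
  assume a: "psd A"
  then have "0 \<le> Re (cinner (axis x 1) (A *v axis x 1))" by (simp add: psd_def)
  moreover have "cnj (A $ x $ x) = A $ x $ x" 
    using a by (metis (no_types, lifting) psd_def dagger_def vec_lambda_beta)
  ultimately show ?thesis by (simp add: mult_axis cinner_axis complex_eq_iff)
qed

lemma psd_entry:
  fixes A :: "complex^'k::finite^'k"
  assumes a: "psd A"
  shows "norm (A $ x $ y) \<le> Re (trace A)"
proof -
  have d: "0 \<le> Re (A $ z $ z)" for z using psd_diag[OF a] by blast
  have tr: "Re (A $ z $ z) \<le> Re (trace A)" for z
    unfolding trace_def Re_sum by (rule member_le_sum) (auto simp: d)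
  have h: "A $ y $ x = cnj (A $ x $ y)" 
    using a by (metis (no_types, lifting) psd_def dagger_def vec_lambda_beta)
  define u where "u = - cnj (sgn (A $ x $ y))"
  have uA: "u * A $ x $ y = - of_real (norm (A $ x $ y))"
  proof (cases "A $ x $ y = 0")
    case False
    have "cnj (A $ x $ y) * A $ x $ y = of_real (norm (A $ x $ y) * norm (A $ x $ y))"
      by (metis complex_norm_square mult.commute of_real_mult power2_eq_square)
    with False show ?thesis unfolding u_def by (simp add: sgn_eq)
  qed simp
  have uu: "Re (cnj u * u * A $ y $ y) \<le> Re (A $ y $ y)"
  proof -
    have "cnj u * u = of_real ((norm u)\<^sup>2)" by (simp add: complex_norm_square mult.commute del: of_real_power)
    moreover have "(norm u)\<^sup>2 \<le> 1" by (simp add: u_def norm_sgn)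
    ultimately show ?thesis using d[of y] by (simp add: mult_left_le_one_le)
  qed
  have "0 \<le> Re (cinner (axis x 1 + axis y u) (A *v (axis x 1 + axis y u)))" using a by (simp add: psd_def)
  also have "cinner (axis x 1 + axis y u) (A *v (axis x 1 + axis y u)) = 
     A $ x $ x + cnj u * u * A $ y $ y + u * A $ x $ y + cnj (u * A $ x $ y)"
    by (simp add: matrix_vector_right_distrib cinner_lin mult_axis cinner_axis h algebra_simps)
  finally have "2 * norm (A $ x $ y) \<le> Re (A $ x $ x) + Re (A $ y $ y)"
    using uu unfolding uA by simp
  then show ?thesis using tr[of x] tr[of y] by linarith
qed

lemma psd_trace: 
  assumes a: "psd A"
  shows "trace A = of_real (Re (trace A))" "0 \<le> Re (trace A)"
  using psd_diag[OF a] unfolding trace_def by (auto simp: Re_sum intro!: sum_nonneg sum.cong)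

lemma psd_trace0: "psd A \<Longrightarrow> Re (trace A) \<le> 0 \<Longrightarrow> A = 0"
  using psd_entry[of A] by (simp add: vec_eq_iff) (meson norm_le_zero_iff order_trans)

lemma trace_scaleR: "trace (r *\<^sub>R A) = r *\<^sub>R trace (A :: complex^'k^'k)"
  by (simp add: trace_def scaleR_sum_right)

lemma scaleR_mv: "(r *\<^sub>R (A::complex^'k^'k)) *v v = r *\<^sub>R (A *v v)"
  by (simp add: matrix_vector_mult_def vec_eq_iff scaleR_sum_right)

lemma psd_scaleR: "psd (A :: complex^'k::finite^'k) \<Longrightarrow> 0 \<le> r \<Longrightarrow> psd (r *\<^sub>R A)"
  unfolding psd_def
  by (simp add: dagger_simps scaleR_mv cinner_lin)

lemma scaleR_mm: "(A::complex^'k^'k) ** (r *\<^sub>R B) = r *\<^sub>R (A ** B)" "(r *\<^sub>R A) ** B = r *\<^sub>R (A ** B)"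
  by (simp_all add: matrix_matrix_mult_def vec_eq_iff scaleR_sum_right)

lemma mm_diff:
  "((A::complex^'k^'k) - B) ** C = A ** C - B ** C"
  "(C::complex^'k^'k) ** (A - B) = C ** A - C ** B"
  by (simp_all add: matrix_matrix_mult_def vec_eq_iff algebra_simps sum_subtractf)

lemma density_normalize:
  assumes "psd A" "0 < Re (trace A)"
  shows "density_op (A /\<^sub>R Re (trace A))"
  unfolding density_op_def using assms psd_trace(1)[OF assms(1)]
  by (auto intro!: psd_scaleR simp: trace_scaleR) (metis of_real_1 of_real_mult less_irrefl left_inverse scaleR_conv_of_real) 

lemma outer_product:
  fixes v :: "complex^'k::finite" 
  defines "P \<equiv> (\<chi> x y. v $ x * cnj (v $ y))"
  shows "psd P" "trace (A ** P) = cinner v (A *v v)"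
proof -
  have "P *v w = (\<chi> x. v $ x * cinner v w)" for w
    by (simp add: P_def matrix_vector_mult_def cinner_def sum_distrib_left mult.assoc)
  then have "cinner w (P *v w) = cinner w v * cinner v w" for w
    by (simp add: cinner_def[of w] sum_distrib_right mult.assoc)
  moreover have "cinner w v * cinner v w = of_real ((norm (cinner w v))\<^sup>2)" for w
    by (metis cnj_cinner complex_norm_square)
  ultimately show "psd P" by (simp add: psd_def P_def dagger_def mult.commute)
  show "trace (A ** P) = cinner v (A *v v)"
    unfolding trace_def matrix_matrix_mult_def P_def cinner_def matrix_vector_mult_def
    by (simp add: sum_distrib_left mult_ac)
qed

lemma compact_density: "compact {\<rho> :: complex^'k::finite^'k. density_op \<rho>}"
proof -
  have "closed {\<rho> :: complex^'k^'k. density_op \<rho>}"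
    unfolding density_op_def psd_def trace_def dagger_def cinner_def matrix_vector_mult_def
    by (intro closed_Collect_conj closed_Collect_all closed_Collect_eq closed_Collect_le continuous_intros)
  moreover have "bounded {\<rho> :: complex^'k^'k. density_op \<rho>}"
  proof (rule boundedI)
    fix \<rho> :: "complex^'k^'k" assume "\<rho> \<in> {\<rho>. density_op \<rho>}"
    then have e: "norm (\<rho> $ x $ y) \<le> 1" for x y using psd_entry[of \<rho> x y] by (simp add: density_op_def)
    have "norm \<rho> \<le> (\<Sum>x\<in>UNIV. norm (\<rho> $ x))" unfolding norm_vec_def by (rule L2_set_le_sum) simp
    also have "\<dots> \<le> (\<Sum>x\<in>UNIV. \<Sum>y\<in>UNIV. norm (\<rho> $ x $ y))" 
      by (rule sum_mono) (simp add: norm_vec_def L2_set_le_sum)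
    also have "\<dots> \<le> (\<Sum>x\<in>(UNIV::'k set). \<Sum>y\<in>(UNIV::'k set). 1)" by (intro sum_mono e)
    finally show "norm \<rho> \<le> (\<Sum>x\<in>(UNIV::'k set). \<Sum>y\<in>(UNIV::'k set). 1)" .
  qed
  ultimately show ?thesis by (simp add: compact_eq_bounded_closed)
qed

lemma min_eigenvalue:
  fixes H :: "complex^'k::finite^'k"
  assumes herm: "dagger H = H"
  shows "(\<forall>\<rho>. density_op \<rho> \<longrightarrow> c \<le> Re (trace (H ** \<rho>))) \<longleftrightarrow>
    (\<forall>e v. v \<noteq> 0 \<and> H *v v = complex_of_real e *s v \<longrightarrow> c \<le> e)"
proof (intro iffI allI impI; (elim conjE)?)
  fix e v assume tr: "\<forall>\<rho>. density_op \<rho> \<longrightarrow> c \<le> Re (trace (H ** \<rho>))" 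
    and v: "v \<noteq> 0" "H *v v = complex_of_real e *s v"
  define P :: "complex^'k^'k" where "P = (\<chi> x y. v $ x * cnj (v $ y))"
  define r where "r = (norm v)\<^sup>2"
  have r: "r > 0" using v by (simp add: r_def)
  have P: "psd P" "\<And>A. trace (A ** P) = cinner v (A *v v)"
    unfolding P_def by (rule outer_product)+
  have t: "Re (trace P) = r"
    using P(2)[of "mat 1"] by (simp add: cinner_self r_def del: of_real_power)
  have "complex_of_real e *s v = e *\<^sub>R v"
    unfolding vec_eq_iff vector_scaleR_component vector_smult_component by (simp add: scaleR_conv_of_real)
  then have H: "Re (trace (H ** P)) = e * r"
    by (simp add: P(2) v cinner_lin cinner_self r_def del: of_real_power)
  have "density_op (P /\<^sub>R Re (trace P))"
    by (rule density_normalize[OF P(1)]) (simp add: t r)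
  then have "c \<le> Re (trace (H ** (P /\<^sub>R r)))" using tr unfolding t by metis
  also have "\<dots> = e" using r by (simp add: scaleR_mm trace_scaleR H)
  finally show "c \<le> e" .
next
  fix \<sigma> :: "complex^'k^'k" assume ev: "\<forall>e v. v \<noteq> 0 \<and> H *v v = complex_of_real e *s v \<longrightarrow> c \<le> e" and \<sigma>: "density_op \<sigma>"
  let ?D = "{\<rho> :: complex^'k^'k. density_op \<rho>}"
  have ne: "?D \<noteq> {}" using \<sigma> by force
  define g where "g = (\<lambda>\<rho>. Re (trace (H ** \<rho>)))"
  have cont: "continuous_on ?D g"
    unfolding g_def
    unfolding trace_def matrix_matrix_mult_def vec_lambda_beta
    by (intro continuous_on_Re continuous_on_sum continuous_on_mult continuous_on_const
        continuous_on_component continuous_on_id)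
  obtain \<rho> where "\<rho> \<in> ?D" and "\<forall>\<rho>'\<in>?D. g \<rho> \<le> g \<rho>'"
    using continuous_attains_inf[OF compact_density ne cont] by (elim bexE)
  then have \<rho>: "density_op \<rho>"
    and min: "\<And>\<rho>'. density_op \<rho>' \<Longrightarrow> Re (trace (H ** \<rho>)) \<le> Re (trace (H ** \<rho>'))"
    by (simp_all add: g_def)
  define m where "m = Re (trace (H ** \<rho>))"
  define A where "A = H - m *\<^sub>R mat 1"
  have hA: "dagger A = A" by (simp add: A_def dagger_simps herm)
  have trA: "Re (trace (A ** X)) = Re (trace (H ** X)) - m * Re (trace X)" for X
    by (simp add: A_def mm_diff scaleR_mm trace_sub trace_scaleR)
  have p\<rho>: "psd \<rho>" and t\<rho>: "trace \<rho> = 1" using \<rho> by (auto simp: density_op_def)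
  have A\<rho>: "Re (trace (A ** \<rho>)) = 0" by (simp add: trA t\<rho> m_def)
  have pos: "0 \<le> Re (trace (A ** X))" if X: "psd X" for X
  proof (cases "Re (trace X) > 0")
    case True
    from min[OF density_normalize[OF X True]] True have "m * Re (trace X) \<le> Re (trace (H ** X))"
      by (simp add: m_def scaleR_mm trace_scaleR field_simps)
    then show ?thesis by (simp add: trA)
  next
    case False
    then show ?thesis using psd_trace0[OF X] by (simp add: trace_def)
  qed
  have "0 \<le> - 2 * t * Re (trace (A ** \<rho> ** A)) + t\<^sup>2 * Re (trace (A ** (A ** \<rho> ** A)))" for t :: real
  proof -
    let ?B = "mat 1 - t *\<^sub>R A"
    have "0 \<le> Re (trace (A ** (?B ** \<rho> ** dagger ?B)))" by (intro pos psd_conj p\<rho>)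
    also have "?B ** \<rho> ** dagger ?B = \<rho> - t *\<^sub>R (A ** \<rho>) - t *\<^sub>R (\<rho> ** A - t *\<^sub>R (A ** \<rho> ** A))"
      by (simp only: dagger_simps hA mm_diff scaleR_mm
          matrix_mul_lid matrix_mul_rid)
    also have "A ** \<dots> = A ** \<rho> - t *\<^sub>R (A ** (A ** \<rho>))
        - t *\<^sub>R (A ** \<rho> ** A - t *\<^sub>R (A ** (A ** \<rho> ** A)))"
      by (simp only: mm_diff scaleR_mm matrix_mul_assoc)
    also have "Re (trace \<dots>) = - 2 * t * Re (trace (A ** \<rho> ** A)) + t\<^sup>2 * Re (trace (A ** (A ** \<rho> ** A)))"
      using A\<rho> trace_mul_sym[of A "A ** \<rho>"]
      unfolding trace_sub trace_scaleR by (simp add: power2_eq_square) (simp add: algebra_simps)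
    finally show ?thesis .
  qed
  from nonpos_of_quadratic[OF this] have le: "Re (trace (A ** \<rho> ** A)) \<le> 0" .
  have "psd (A ** \<rho> ** A)" using psd_conj[OF p\<rho>, of A] by (simp only: hA)
  then have 0: "A ** \<rho> ** A = 0" by (rule psd_trace0[OF _ le])
  have "\<rho> *v (A *v v) = 0" for v
  proof (rule psd_kernel[OF p\<rho>])
    have "cinner (A *v v) (\<rho> *v (A *v v)) = cinner v ((A ** \<rho> ** A) *v v)"
      using cinner_dagger[of v A] by (simp add: hA matrix_vector_mul_assoc[symmetric])
    then show "Re (cinner (A *v v) (\<rho> *v (A *v v))) = 0" by (simp add: 0 cinner_def)
  qed
  then have "\<rho> ** A = 0" by (simp add: matrix_vector_mul_assoc matrix_eq)
  then have "dagger (\<rho> ** A) = 0" by (simp add: dagger_def vec_eq_iff)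
  then have A0: "A ** \<rho> = 0" using p\<rho> by (simp add: dagger_mult hA psd_def)
  have "\<rho> \<noteq> 0" using t\<rho> by (auto simp: trace_def)
  then obtain w where w: "\<rho> *v w \<noteq> 0" using matrix_eq[of \<rho> 0] by auto
  have "A *v (\<rho> *v w) = 0" by (simp add: matrix_vector_mul_assoc A0)
  then have "H *v (\<rho> *v w) = m *\<^sub>R (\<rho> *v w)"
    by (simp add: A_def matrix_vector_mult_diff_rdistrib scaleR_mv)
  also have "\<dots> = complex_of_real m *s (\<rho> *v w)"
    unfolding vec_eq_iff vector_scaleR_component vector_smult_component by (simp add: scaleR_conv_of_real)
  finally have "c \<le> m" using ev w by blast
  then show "c \<le> Re (trace (H ** \<sigma>))" using min[OF \<sigma>] by (simp add: m_def)
qed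

lemma dagger_hamiltonian: "dagger (hamiltonian L C) = hamiltonian L C"
  by (auto simp: hamiltonian_def dagger_def projector_def vec_eq_iff mult.commute intro!: sum.cong)

lemma no_instance_iff_eigenvalues:
  "no_instance L C c \<longleftrightarrow>
     (\<forall>\<alpha>\<in>{1..L}. valid_clause (C \<alpha>)) \<and>
     (\<forall>e v. v \<noteq> 0 \<and> hamiltonian L C *v v = complex_of_real e *s v \<longrightarrow> c \<le> e)"
  unfolding no_instance_def min_eigenvalue[OF dagger_hamiltonian] ..

text \<open>
  \<open>step \<mu> L C\<close> is a Markov kernel, so the monadic binds denote the intended integrals and
  \<open>run \<mu> L C t\<close> is a probability measure.
\<close>

lemma measurable_vec_lambda[measurable (raw)]:
  fixes f :: "'a \<Rightarrow> 'i::finite \<Rightarrow> 'b::euclidean_space"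
  assumes "\<And>i. (\<lambda>w. f w i) \<in> borel_measurable M"
  shows "(\<lambda>w. \<chi> i. f w i) \<in> borel_measurable M"
proof (subst borel_measurable_euclidean_space, rule ballI)
  fix b :: "'b^'i" assume "b \<in> Basis"
  then obtain i u where b: "b = axis i u" by (auto simp: Basis_vec_def)
  have "(\<lambda>w. f w i \<bullet> u) \<in> borel_measurable M"
    by (intro borel_measurable_inner assms borel_measurable_const)
  then show "(\<lambda>w. (\<chi> i. f w i) \<bullet> b) \<in> borel_measurable M" by (simp add: b inner_axis)
qed

lemma measurable_vec_nth2[measurable]:
  "(\<lambda>A :: complex^'i::finite^'j::finite. A $ x $ y) \<in> borel_measurable borel"
  by (intro borel_measurable_continuous_onI continuous_intros)

lemma measurable_mm[measurable (raw)]: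
  fixes f g :: "'a \<Rightarrow> complex^'i::finite^'i::finite"
  assumes [measurable]: "f \<in> borel_measurable M" "g \<in> borel_measurable M"
  shows "(\<lambda>w. f w ** g w) \<in> borel_measurable M"
  unfolding matrix_matrix_mult_def by measurable

lemma measurable_outcome_prob[measurable]: "outcome_prob P \<in> borel_measurable borel"
  unfolding outcome_prob_def[abs_def] trace_def by measurable
lemma measurable_post_state[measurable]: "post_state P \<in> borel_measurable borel"
  unfolding post_state_def[abs_def] by measurable
lemma measurable_on_qubit[measurable]: "on_qubit q \<in> borel_measurable borel"
  unfolding on_qubit_def[abs_def] by measurable
lemma measurable_dagger[measurable]: "dagger \<in> borel_measurable (borel :: (complex^'i::finite^'i) measure)"
  unfolding dagger_def[abs_def]
  by (intro measurable_vec_lambda borel_measurable_continuous_onI continuous_intros)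


lemma measurable_bernoulli_pmf: "(\<lambda>p. measure_pmf (bernoulli_pmf p)) \<in> borel \<rightarrow>\<^sub>M prob_algebra (count_space UNIV)"
proof (rule measurable_prob_algebraI)
  show "(\<lambda>p. measure_pmf (bernoulli_pmf p)) \<in> borel \<rightarrow>\<^sub>M subprob_algebra (count_space UNIV)"
  proof (rule measurable_subprob_algebra)
    fix A :: "bool set"
    have 1: "pmf (bernoulli_pmf p) b = (if b then min 1 (max 0 p) else 1 - min 1 (max 0 p))" for p b
      by (cases b) (simp_all add: bernoulli_pmf.rep_eq)
    have "emeasure (measure_pmf (bernoulli_pmf p)) A = (\<Sum>b\<in>A. ennreal (if b then min 1 (max 0 p) else 1 - min 1 (max 0 p)))" for p
      unfolding 1[symmetric] by (subst emeasure_measure_pmf_finite) simp_all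
    then show "(\<lambda>p. emeasure (measure_pmf (bernoulli_pmf p)) A) \<in> borel_measurable borel" by simp
  qed (simp_all add: measure_pmf.subprob_space_axioms)
qed (rule measure_pmf.prob_space_axioms)

lemma measurable_swap_countable:
  fixes f :: "'a \<Rightarrow> 'x::countable \<Rightarrow> 'b"
  assumes "\<And>x. (\<lambda>\<rho>. f \<rho> x) \<in> M \<rightarrow>\<^sub>M N"
  shows "(\<lambda>(\<rho>,x). f \<rho> x) \<in> M \<Otimes>\<^sub>M count_space UNIV \<rightarrow>\<^sub>M N"
  unfolding case_prod_beta
  by (rule measurable_compose_countable[where f="\<lambda>x p. f (fst p) x" and g=snd])
     (use assms in \<open>simp_all add: measurable_compose[OF measurable_fst]\<close>)

lemma measurable_swap_finite:
  fixes f :: "'a \<Rightarrow> 'x::finite \<Rightarrow> 'b"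
  assumes "\<And>x. (\<lambda>\<rho>. f \<rho> x) \<in> M \<rightarrow>\<^sub>M N"
  shows "(\<lambda>(\<rho>,x). f \<rho> x) \<in> M \<Otimes>\<^sub>M count_space UNIV \<rightarrow>\<^sub>M N"
  unfolding case_prod_beta
  by (rule measurable_compose_countable'[where f="\<lambda>x p. f (fst p) x" and g=snd and I=UNIV])
     (use assms in \<open>simp_all add: measurable_compose[OF measurable_fst] countable_finite\<close>)

lemma measure_pmf_in_prob_algebra: "measure_pmf p \<in> space (prob_algebra (count_space UNIV))"
    by (simp add: space_prob_algebra measure_pmf.prob_space_axioms)

lemma measurable_step:
  fixes C :: "nat \<Rightarrow> 'q::finite clause"
  assumes "haar_measure \<mu>"
  shows "step \<mu> L C \<in> borel \<rightarrow>\<^sub>M prob_algebra (count_space UNIV \<Otimes>\<^sub>M borel)"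
proof -
  have mu: "\<mu> \<in> space (prob_algebra borel)" using assms by (simp add: haar_measure_def space_prob_algebra)
  have m1: "(\<lambda>x. distr \<mu> (count_space UNIV \<Otimes>\<^sub>M borel) (\<lambda>U.
           (True, on_qubit q U ** post_state P x ** dagger (on_qubit q U)))) \<in> borel \<rightarrow>\<^sub>M prob_algebra (count_space UNIV \<Otimes>\<^sub>M borel)" for P and q :: 'q
    by (rule measurable_distr_prob_space2[where M=borel]) (use mu in \<open>simp, measurable\<close>)
  show ?thesis
    unfolding step_def[abs_def]
    apply (rule measurable_bind_prob_space2[where N="count_space UNIV", OF measurable_const[OF measure_pmf_in_prob_algebra]])
    apply (rule measurable_swap_countable)
    apply (rule measurable_bind_prob_space2[where N="count_space UNIV", OF measurable_compose[OF _ measurable_bernoulli_pmf]])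
     apply (measurable)[1]
    apply (rule measurable_swap_finite)
    subgoal for \<alpha> b
      apply (cases b)
       apply simp
       apply (rule measurable_bind_prob_space2[OF measurable_const[OF measure_pmf_in_prob_algebra]])
       apply (rule measurable_swap_finite)
       apply (rule m1)
      apply simp
      apply measurable
      done
    done
qed

lemma run_in_prob_algebra:
  fixes C :: "nat \<Rightarrow> 'q::finite clause"
  assumes "haar_measure \<mu>"
  shows "run \<mu> L C t \<in> space (prob_algebra (count_space UNIV \<Otimes>\<^sub>M borel))"
proof (induction t)
  case 0
  then show ?case by (simp add: space_prob_algebra prob_space_return space_pair_measure)
next
  case (Suc t)
  note [measurable] = measurable_step[OF assms]
  have k: "(\<lambda>(bs, \<rho>).
     distr (step \<mu> L C \<rho>) (count_space UNIV \<Otimes>\<^sub>M borel) (\<lambda>(b, \<rho>'). (bs @ [b], \<rho>')))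
    \<in> count_space (UNIV::bool list set) \<Otimes>\<^sub>M borel \<rightarrow>\<^sub>M prob_algebra (count_space UNIV \<Otimes>\<^sub>M borel)"
    apply (rule measurable_pair_measure_countable1)
     apply simp
    apply (simp only: prod.case)
    apply (rule measurable_compose[OF measurable_step[OF assms]])
    apply (rule measurable_distr_prob_space)
    by measurable
  show ?case
    using prob_space_bind'[OF Suc k] sets_bind'[OF Suc k] by (simp add: space_prob_algebra)
qed

end

theory Submission
  imports Defs
begin

text \<open>
  As long as the state is a density operator, a step yields outcome 1 with probability at least
  \<open>c / L\<close>, whatever happened before. Hence the expectation of \<open>2 ^ (- number of ones)\<close> shrinks in
  every step by a factor of at most \<open>exp (- c / (2 * L))\<close>, and Markov's inequality bounds the
  probability of fewer than \<open>T - N \<le> 2 * f * L * n\<^sup>2\<close> ones.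
\<close>

section \<open>Projectors and local unitaries\<close>

lemma dagger_projector: "dagger (projector D) = projector D"
  by (auto simp: dagger_def projector_def vec_eq_iff mult.commute)

lemma sum_cnj_state:
  assumes "norm s = 1"
  shows "(\<Sum>a\<in>UNIV. cnj (s $ a) * s $ a) = 1"
  using cinner_self[of s] assms by (simp add: cinner_def)

text \<open>In the sum over the middle index \<open>z\<close>, the nonzero terms have
  \<open>z\<close> equal to \<open>x\<close> off the two qubits. Such a \<open>z\<close> is
  determined by the bit pair \<open>(z i, z j)\<close>, so the sum collapses to the squared norm of
  the clause state, which is 1.\<close>

lemma projector_idem:
  fixes D :: "'q::finite clause"
  assumes "valid_clause D"
  shows "projector D ** projector D = projector D"
proof -
  define i j s where "i = qubit1 D" and "j = qubit2 D" and "s = state D"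
  have ij: "i \<noteq> j" and s: "norm s = 1" using assms by (auto simp: valid_clause_def i_def j_def s_def)
  define ag where "ag x y \<longleftrightarrow> (\<forall>k. k \<noteq> i \<and> k \<noteq> j \<longrightarrow> x k = y k)" for x y :: "'q \<Rightarrow> bool"
  have ag_trans: "ag x y" if "ag x z" "ag z y" for x y z using that by (simp add: ag_def)
  have ag_sym: "ag x y \<Longrightarrow> ag y x" for x y by (simp add: ag_def)
  have p: "projector D $ x $ y = (if ag x y then s $ (x i, x j) * cnj (s $ (y i, y j)) else 0)" for x y
    by (simp only: projector_def ag_def i_def j_def s_def vec_lambda_beta)
  have 1: "(\<Sum>z | ag x z. cnj (s $ (z i, z j)) * s $ (z i, z j)) = 1" for x
  proof -
    have "(\<Sum>z | ag x z. cnj (s $ (z i, z j)) * s $ (z i, z j)) = (\<Sum>a\<in>UNIV. cnj (s $ a) * s $ a)"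
      by (rule sum.reindex_bij_witness[where i = "\<lambda>a. x(i := fst a, j := snd a)" and j = "\<lambda>z. (z i, z j)"])
        (auto simp: ag_def fun_eq_iff ij)
    then show ?thesis using sum_cnj_state[OF s] by simp
  qed
  have "(projector D ** projector D) $ x $ y = projector D $ x $ y" for x y
  proof -
    \<comment> \<open>Once \<open>ag x z\<close> holds, \<open>ag z y\<close> is equivalent to
      \<open>ag x y\<close>. The condition on \<open>y\<close> thus becomes independent of
      \<open>z\<close> and leaves the sum.\<close>
    have "(projector D ** projector D) $ x $ y =
        (\<Sum>z\<in>UNIV. if ag x z then (if ag x y then s $ (x i, x j) * cnj (s $ (y i, y j))
           * (cnj (s $ (z i, z j)) * s $ (z i, z j)) else 0) else 0)"
      unfolding matrix_matrix_mult_def vec_lambda_beta p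
      by (rule sum.cong) (auto intro: ag_trans ag_sym)
    also have "\<dots> = (if ag x y then s $ (x i, x j) * cnj (s $ (y i, y j))
           * (\<Sum>z | ag x z. cnj (s $ (z i, z j)) * s $ (z i, z j)) else 0)"
      by (simp add: sum.If_cases sum_distrib_left)
    finally show ?thesis by (simp add: 1 p)
  qed
  then show ?thesis by (simp add: vec_eq_iff)
qed

lemma dagger_on_qubit: "dagger (on_qubit q U) = on_qubit q (dagger U)"
  by (auto simp: dagger_def on_qubit_def vec_eq_iff)

text \<open>As for \<open>projector_idem\<close>, contributing middle indices differ from
  \<open>x\<close> at most in qubit \<open>q\<close>, so the sum over basis states becomes a sum
  over one bit. This carries unitarity from the one-qubit matrix to \<open>on_qubit\<close>.\<close>

lemma on_qubit_mult: "on_qubit q U ** on_qubit q V = on_qubit (q :: 'q::finite) (U ** V)"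
proof -
  define ag where "ag x y \<longleftrightarrow> (\<forall>k. k \<noteq> q \<longrightarrow> x k = y k)" for x y :: "'q \<Rightarrow> bool"
  have ag_trans: "ag x y" if "ag x z" "ag z y" for x y z using that by (simp add: ag_def)
  have ag_sym: "ag x y \<Longrightarrow> ag y x" for x y by (simp add: ag_def)
  have p: "on_qubit q U $ x $ y = (if ag x y then U $ x q $ y q else 0)" for x y U
    by (simp only: on_qubit_def ag_def vec_lambda_beta)
  have "(on_qubit q U ** on_qubit q V) $ x $ y = on_qubit q (U ** V) $ x $ y" for x y
  proof -
    have "(on_qubit q U ** on_qubit q V) $ x $ y =
        (\<Sum>z\<in>UNIV. if ag x z then (if ag x y then U $ x q $ z q * V $ z q $ y q else 0) else 0)"
      unfolding matrix_matrix_mult_def[of "on_qubit q U"] vec_lambda_beta p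
      by (rule sum.cong) (auto intro: ag_trans ag_sym)
    also have "\<dots> = (if ag x y then (\<Sum>z | ag x z. U $ x q $ z q * V $ z q $ y q) else 0)"
      by (simp add: sum.If_cases)
    also have "(\<Sum>z | ag x z. U $ x q $ z q * V $ z q $ y q) = (\<Sum>a\<in>UNIV. U $ x q $ a * V $ a $ y q)"
      by (rule sum.reindex_bij_witness[where i = "\<lambda>a. x(q := a)" and j = "\<lambda>z. z q"])
        (auto simp: ag_def fun_eq_iff)
    finally show ?thesis by (simp add: p matrix_matrix_mult_def)
  qed
  then show ?thesis by (simp add: vec_eq_iff)
qed

lemma on_qubit_mat1: "on_qubit q (mat 1) = mat 1"
  by (auto simp: on_qubit_def mat_def vec_eq_iff fun_eq_iff)

lemma unitary_on_qubit: "unitary U \<Longrightarrow> unitary (on_qubit q U)"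
  by (simp add: unitary_def dagger_on_qubit on_qubit_mult on_qubit_mat1)

section \<open>Density operators\<close>

lemma density_op_unitary_conj:
  assumes "density_op \<rho>" "unitary U"
  shows "density_op (U ** \<rho> ** dagger U)"
proof -
  have "trace (U ** \<rho> ** dagger U) = trace (dagger U ** U ** \<rho>)"
    by (simp add: trace_mul_sym[of _ "dagger U"] matrix_mul_assoc)
  then show ?thesis using assms by (simp add: density_op_def psd_conj unitary_def)
qed

text \<open>By cyclicity of the trace. It identifies the normalizing factor in
  \<open>post_state\<close> with the trace of a positive operator, so that
  \<open>density_normalize\<close> applies.\<close>

lemma outcome_prob_conj:
  assumes "P ** P = P"
  shows "outcome_prob P \<rho> = Re (trace (P ** \<rho> ** P))"
  by (simp add: outcome_prob_def trace_mul_sym[of _ P] matrix_mul_assoc assms)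

lemma outcome_prob_nonneg:
  assumes "dagger P = P" "P ** P = P" "density_op \<rho>"
  shows "0 \<le> outcome_prob P \<rho>"
proof -
  have "psd (P ** \<rho> ** P)" using psd_conj[of \<rho> P] assms by (simp add: density_op_def)
  then show ?thesis using psd_trace(2) by (simp add: outcome_prob_conj[OF assms(2)])
qed

lemma outcome_prob_compl:
  assumes "density_op \<rho>"
  shows "outcome_prob (mat 1 - P) \<rho> = 1 - outcome_prob P \<rho>"
  using assms by (simp add: outcome_prob_def mm_diff trace_sub density_op_def)

lemma density_op_post_state:
  assumes "dagger P = P" "P ** P = P" "density_op \<rho>" "outcome_prob P \<rho> > 0"
  shows "density_op (post_state P \<rho>)"
proof -
  have "psd (P ** \<rho> ** P)" using psd_conj[of \<rho> P] assms by (simp add: density_op_def)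
  then show ?thesis
    using density_normalize assms(4) unfolding post_state_def outcome_prob_conj[OF assms(2)] by blast
qed

lemma projection_compl:
  assumes "dagger P = P" "P ** P = (P :: complex^'k::finite^'k)"
  shows "dagger (mat 1 - P) = mat 1 - P" "(mat 1 - P) ** (mat 1 - P) = mat 1 - P"
  by (simp_all add: assms dagger_simps mm_diff)

lemma density_op_maximally_mixed:
  "density_op (mat 1 /\<^sub>R 2 ^ CARD('q) :: 'q::finite op)"
proof -
  have "psd (mat 1 :: 'q op)" by (simp add: psd_def dagger_simps cinner_self del: of_real_power)
  moreover have "trace (mat 1 :: 'q op) = of_real (2 ^ CARD('q))"
    by (simp add: trace_def mat_def card_fun)
  ultimately show ?thesis using density_normalize[of "mat 1 :: 'q op"] by simp
qed

text \<open>A compact set is closed, hence Borel. The weight used for the whole run branches on this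
  predicate.\<close>

lemma density_op_measurable [measurable]:
  "Measurable.pred borel (density_op :: complex^'k::finite^'k \<Rightarrow> bool)"
  unfolding pred_def using borel_closed[OF compact_imp_closed[OF compact_density]] by simp

section \<open>One step\<close>

lemma nn_integral_pmf_bind:
  assumes "\<And>x. K x \<in> space (prob_algebra N)" "h \<in> borel_measurable N"
  shows "(\<integral>\<^sup>+w. h w \<partial>(measure_pmf p \<bind> K)) = (\<integral>\<^sup>+x. (\<integral>\<^sup>+w. h w \<partial>K x) \<partial>measure_pmf p)"
proof (rule nn_integral_bind[OF assms(2)])
  have "K x \<in> space (subprob_algebra N)" for x
    using assms(1)[of x] by (auto simp: space_prob_algebra space_subprob_algebra intro: prob_space_imp_subprob_space)
  then show "K \<in> measurable (measure_pmf p) (subprob_algebra N)" by simp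
qed

lemma bind_pmf_in_prob_algebra:
  assumes "\<And>x. K x \<in> space (prob_algebra N)"
  shows "measure_pmf p \<bind> K \<in> space (prob_algebra N)"
proof -
  have "K \<in> count_space UNIV \<rightarrow>\<^sub>M prob_algebra N" using assms by simp
  from prob_space_bind'[OF measure_pmf_in_prob_algebra this] sets_bind'[OF measure_pmf_in_prob_algebra this]
  show ?thesis by (simp add: space_prob_algebra)
qed

text \<open>For a fixed clause the expectation is at most a mixture of \<open>g True\<close> and
  \<open>g False\<close>, affine in the outcome probability. Averaging over the clauses turns these
  probabilities into the energy divided by \<open>L\<close>. The bound on \<open>h\<close> is
  required at density operators alone, so that \<open>h\<close> may take the value \<top>
  elsewhere.\<close>

lemma nn_integral_step_le:
  fixes C :: "nat \<Rightarrow> 'q::finite clause" and h :: "bool \<times> 'q op \<Rightarrow> ennreal"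
  assumes haar: "haar_measure \<mu>" and L: "L \<ge> 1" and valid: "\<forall>\<alpha>\<in>{1..L}. valid_clause (C \<alpha>)"
    and dens: "density_op \<rho>"
    and h [measurable]: "h \<in> borel_measurable (count_space UNIV \<Otimes>\<^sub>M borel)"
    and le: "\<And>b \<rho>'. density_op \<rho>' \<Longrightarrow> h (b, \<rho>') \<le> ennreal (g b)"
    and g: "\<And>b. 0 \<le> g b"
  shows "(\<integral>\<^sup>+w. h w \<partial>step \<mu> L C \<rho>) \<le>
    ennreal (g False - (g False - g True) * (Re (trace (hamiltonian L C ** \<rho>)) / L))"
proof -
  let ?N = "count_space (UNIV :: bool set) \<Otimes>\<^sub>M (borel :: 'q op measure)"
  let ?P = "\<lambda>\<alpha>. projector (C \<alpha>)"
  let ?p = "\<lambda>\<alpha>. outcome_prob (?P \<alpha>) \<rho>"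
  have mu: "prob_space \<mu>" and smu [measurable_cong]: "sets \<mu> = sets borel" and AEu: "AE U in \<mu>. unitary U"
    using haar by (auto simp: haar_measure_def)
  \<comment> \<open>\<open>K1\<close>, \<open>K2\<close> and \<open>K3\<close> name the nested
    kernels of \<open>step\<close>: the law once the qubit, the outcome or the clause, respectively,
    has been drawn. The integral is then unfolded one layer at a time.\<close>
  define K1 where "K1 \<alpha> = (\<lambda>q. distr \<mu> ?N (\<lambda>U.
           (True, on_qubit q U ** post_state (?P \<alpha>) \<rho> ** dagger (on_qubit q U))))" for \<alpha>
  define K2 where "K2 \<alpha> b = (if b then measure_pmf (pmf_of_set {qubit1 (C \<alpha>), qubit2 (C \<alpha>)}) \<bind> K1 \<alpha>
      else return ?N (False, post_state (mat 1 - ?P \<alpha>) \<rho>))" for \<alpha> b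
  define K3 where "K3 \<alpha> = measure_pmf (bernoulli_pmf (?p \<alpha>)) \<bind> K2 \<alpha>" for \<alpha>
  have step: "step \<mu> L C \<rho> = measure_pmf (pmf_of_set {1..L}) \<bind> K3"
    unfolding step_def K3_def[abs_def] K2_def[abs_def] K1_def[abs_def] by (rule refl)
  have meas: "(\<lambda>U. (True, on_qubit q U ** A ** dagger (on_qubit q U))) \<in> \<mu> \<rightarrow>\<^sub>M ?N" for q and A :: "'q op"
    by measurable
  have k1: "K1 \<alpha> q \<in> space (prob_algebra ?N)" for \<alpha> q
    using prob_space.prob_space_distr[OF mu meas] by (simp add: K1_def space_prob_algebra)
  have k2: "K2 \<alpha> b \<in> space (prob_algebra ?N)" for \<alpha> b
    by (auto simp: K2_def intro!: bind_pmf_in_prob_algebra k1)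
      (simp add: space_prob_algebra prob_space_return space_pair_measure)
  have k3: "K3 \<alpha> \<in> space (prob_algebra ?N)" for \<alpha>
    unfolding K3_def by (intro bind_pmf_in_prob_algebra k2)
  have b1: "(\<integral>\<^sup>+w. h w \<partial>K1 \<alpha> q) \<le> ennreal (g True)" if d: "density_op (post_state (?P \<alpha>) \<rho>)" for \<alpha> q
  proof -
    have "(\<integral>\<^sup>+w. h w \<partial>K1 \<alpha> q) =
        (\<integral>\<^sup>+U. h (True, on_qubit q U ** post_state (?P \<alpha>) \<rho> ** dagger (on_qubit q U)) \<partial>\<mu>)"
      unfolding K1_def by (rule nn_integral_distr[OF meas]) (simp add: h)
    also have "\<dots> \<le> (\<integral>\<^sup>+U. ennreal (g True) \<partial>\<mu>)"
      by (intro nn_integral_mono_AE eventually_mono[OF AEu] le density_op_unitary_conj d unitary_on_qubit)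
    finally show ?thesis by (simp add: prob_space.emeasure_space_1[OF mu])
  qed
  have idem: "?P \<alpha> ** ?P \<alpha> = ?P \<alpha>" if "\<alpha> \<in> {1..L}" for \<alpha>
    using that valid by (auto intro: projector_idem)
  \<comment> \<open>\<open>bernoulli_pmf\<close> clamps its parameter to the unit interval. These
    two bounds ensure that the outcome has exactly the probability
    \<open>?p \<alpha>\<close>.\<close>
  have p0: "0 \<le> ?p \<alpha>" if "\<alpha> \<in> {1..L}" for \<alpha>
    by (rule outcome_prob_nonneg[OF dagger_projector idem[OF that] dens])
  have p1: "?p \<alpha> \<le> 1" if "\<alpha> \<in> {1..L}" for \<alpha>
    using outcome_prob_nonneg[OF projection_compl[OF dagger_projector idem[OF that]] dens]
    by (simp add: outcome_prob_compl[OF dens])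
  have b3: "(\<integral>\<^sup>+w. h w \<partial>K3 \<alpha>) \<le> ennreal (g False - (g False - g True) * ?p \<alpha>)"
    if \<alpha>: "\<alpha> \<in> {1..L}" for \<alpha>
  proof -
    note P = dagger_projector[of "C \<alpha>"] idem[OF \<alpha>] and p0 = p0[OF \<alpha>] and p1 = p1[OF \<alpha>]
    note Q = projection_compl[OF P]
    \<comment> \<open>At probability 0 the post-measurement state is the zero matrix, since
      \<open>inverse 0 = 0\<close>, and \<open>h\<close> may be infinite there. The bound is
      therefore proved after multiplication by the probability, using
      \<open>\<top> * 0 = 0\<close>.\<close>
    have T: "(\<integral>\<^sup>+w. h w \<partial>K2 \<alpha> True) * ennreal (?p \<alpha>) \<le> ennreal (g True) * ennreal (?p \<alpha>)"
    proof (cases "?p \<alpha> = 0")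
      case False
      then have "density_op (post_state (?P \<alpha>) \<rho>)"
        using p0 by (intro density_op_post_state P dens) auto
      then have "(\<integral>\<^sup>+q. (\<integral>\<^sup>+w. h w \<partial>K1 \<alpha> q) \<partial>measure_pmf (pmf_of_set {qubit1 (C \<alpha>), qubit2 (C \<alpha>)}))
          \<le> (\<integral>\<^sup>+q. ennreal (g True) \<partial>measure_pmf (pmf_of_set {qubit1 (C \<alpha>), qubit2 (C \<alpha>)}))"
        by (intro nn_integral_mono b1)
      also have "\<dots> = ennreal (g True)" by (simp add: measure_pmf.emeasure_space_1)
      finally show ?thesis
        unfolding K2_def by (intro mult_right_mono) (simp_all add: nn_integral_pmf_bind[OF k1 h])
    qed simp
    \<comment> \<open>The same device for outcome 0, where the degenerate case is
      \<open>?p \<alpha> = 1\<close>.\<close>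
    have F: "(\<integral>\<^sup>+w. h w \<partial>K2 \<alpha> False) * ennreal (1 - ?p \<alpha>) \<le> ennreal (g False) * ennreal (1 - ?p \<alpha>)"
    proof (cases "?p \<alpha> = 1")
      case False
      then have "density_op (post_state (mat 1 - ?P \<alpha>) \<rho>)"
        using p1 by (intro density_op_post_state Q dens) (simp add: outcome_prob_compl[OF dens])
      then show ?thesis
        unfolding K2_def by (intro mult_right_mono) (simp_all add: nn_integral_return space_pair_measure le)
    qed simp
    have "(\<integral>\<^sup>+w. h w \<partial>K3 \<alpha>) = (\<integral>\<^sup>+w. h w \<partial>K2 \<alpha> True) * ennreal (?p \<alpha>)
        + (\<integral>\<^sup>+w. h w \<partial>K2 \<alpha> False) * ennreal (1 - ?p \<alpha>)"
      unfolding K3_def by (simp add: nn_integral_pmf_bind[OF k2 h] p0 p1)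
    also have "\<dots> \<le> ennreal (g True) * ennreal (?p \<alpha>) + ennreal (g False) * ennreal (1 - ?p \<alpha>)"
      by (intro add_mono T F)
    also have "\<dots> = ennreal (g True * ?p \<alpha> + g False * (1 - ?p \<alpha>))"
      using p0 p1 g by (simp add: ennreal_mult)
    also have "g True * ?p \<alpha> + g False * (1 - ?p \<alpha>) = g False - (g False - g True) * ?p \<alpha>"
      by (simp add: algebra_simps)
    finally show ?thesis .
  qed
  \<comment> \<open>The expression is a convex combination of nonnegative values. Nonnegativity lets
    the embedding \<open>ennreal\<close> be pulled out of the sum below.\<close>
  have nn: "0 \<le> g False - (g False - g True) * ?p \<alpha>" if \<alpha>: "\<alpha> \<in> {1..L}" for \<alpha>
  proof -
    have "0 \<le> g False * (1 - ?p \<alpha>) + g True * ?p \<alpha>" using p0[OF \<alpha>] p1[OF \<alpha>] g by simp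
    then show ?thesis by (simp add: algebra_simps)
  qed
  have "(\<integral>\<^sup>+w. h w \<partial>step \<mu> L C \<rho>) = (\<Sum>\<alpha>\<in>{1..L}. \<integral>\<^sup>+w. h w \<partial>K3 \<alpha>) / of_nat L"
    unfolding step nn_integral_pmf_bind[OF k3 h] using L
    by (subst nn_integral_pmf_of_set) auto
  also have "\<dots> \<le> (\<Sum>\<alpha>\<in>{1..L}. ennreal (g False - (g False - g True) * ?p \<alpha>)) / of_nat L"
    by (intro divide_right_mono_ennreal sum_mono b3)
  also have "\<dots> = ennreal ((\<Sum>\<alpha>\<in>{1..L}. g False - (g False - g True) * ?p \<alpha>) / L)"
    unfolding ennreal_of_nat_eq_real_of_nat
    by (subst sum_ennreal, erule nn, rule divide_ennreal, rule sum_nonneg, erule nn) (use L in simp)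
  also have "(\<Sum>\<alpha>\<in>{1..L}. g False - (g False - g True) * ?p \<alpha>) / L =
      g False - (g False - g True) * ((\<Sum>\<alpha>\<in>{1..L}. ?p \<alpha>) / L)"
    using L by (simp add: sum_subtractf sum_distrib_left[symmetric] diff_divide_distrib)
  also have "(\<Sum>\<alpha>\<in>{1..L}. ?p \<alpha>) = Re (trace (hamiltonian L C ** \<rho>))"
  proof -
    have "trace ((\<Sum>\<alpha>\<in>A. ?P \<alpha>) ** \<rho>) = (\<Sum>\<alpha>\<in>A. trace (?P \<alpha> ** \<rho>))" if "finite A" for A :: "nat set"
      using that by induction (simp_all add: trace_def matrix_matrix_mult_def distrib_right sum.distrib)
    then show ?thesis by (simp add: hamiltonian_def outcome_prob_def)
  qed
  finally show ?thesis .
qed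

section \<open>The whole run\<close>

text \<open>
  The value \<open>\<top>\<close> makes a finite integral of the weight also certify that almost surely the state
  is a density operator and that there are \<open>t\<close> outcomes.
\<close>

definition weight :: "nat \<Rightarrow> bool list \<times> 'q::finite op \<Rightarrow> ennreal" where
  "weight t = (\<lambda>(bs, \<rho>). if density_op \<rho> \<and> length bs = t then ennreal ((1/2) ^ count_list bs True) else \<top>)"

lemma measurable_weight [measurable]:
  "weight t \<in> borel_measurable (count_space UNIV \<Otimes>\<^sub>M borel)"
  unfolding weight_def by (rule measurable_pair_measure_countable1) simp_all

text \<open>The bound \<open>one\<close> on the conditional expectation holds at every point,
  including those of weight \<top>, so integrating it against the law of the first \<open>t\<close>
  steps gives one more factor.\<close>

lemma nn_integral_run_weight:
  fixes C :: "nat \<Rightarrow> 'q::finite clause"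
  assumes haar: "haar_measure \<mu>" and L: "L \<ge> 1" and no: "no_instance L C c"
  shows "(\<integral>\<^sup>+w. weight t w \<partial>run \<mu> L C t) \<le> ennreal (exp (- (c / (2 * L))) ^ t)"
proof (induction t)
  case 0
  show ?case
    by (simp add: nn_integral_return space_pair_measure weight_def density_op_maximally_mixed)
next
  case (Suc t)
  let ?N = "count_space (UNIV :: bool list set) \<Otimes>\<^sub>M (borel :: 'q op measure)"
  define r where "r = exp (- (c / (2 * L)))"
  have r: "r > 0" by (simp add: r_def)
  define k where "k = (\<lambda>(bs, \<rho>). distr (step \<mu> L C \<rho>) ?N (\<lambda>(b, \<rho>'). (bs @ [b], \<rho>')))"
  note [measurable] = measurable_step[OF haar]
  have app: "(\<lambda>(b, \<rho>'). (bs @ [b], \<rho>')) \<in> count_space UNIV \<Otimes>\<^sub>M borel \<rightarrow>\<^sub>M ?N" for bs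
    by measurable
  have k: "k \<in> ?N \<rightarrow>\<^sub>M prob_algebra ?N"
    unfolding k_def
    apply (rule measurable_pair_measure_countable1)
     apply simp
    apply (simp only: prod.case)
    apply (rule measurable_compose[OF measurable_step[OF haar]])
    apply (rule measurable_distr_prob_space)
    by measurable
  have sr: "sets (run \<mu> L C t) = sets ?N"
    using run_in_prob_algebra[OF haar, of L C t] by (simp add: space_prob_algebra)
  have k': "k \<in> run \<mu> L C t \<rightarrow>\<^sub>M subprob_algebra ?N"
    using measurable_prob_algebraD[OF k] by (simp cong: measurable_cong_sets add: sr)
  have one: "(\<integral>\<^sup>+w. weight (Suc t) w \<partial>k (bs, \<rho>)) \<le> ennreal r * weight t (bs, \<rho>)" for bs and \<rho> :: "'q op"
  proof (cases "density_op \<rho> \<and> length bs = t")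
    \<comment> \<open>Here \<open>weight t\<close> is \<top>, and since \<open>r > 0\<close> the
      right-hand side is \<top> too.\<close>
    case False
    then show ?thesis using r by (auto simp: weight_def ennreal_mult_top)
  next
    case True
    then have d: "density_op \<rho>" and l: "length bs = t" by auto
    define m :: real where "m = (1/2) ^ count_list bs True"
    have m: "m > 0" by (simp add: m_def)
    \<comment> \<open>The new weight as a function of the next outcome: a 1 halves it, a 0 keeps
      it.\<close>
    define g where "g b = (if b then m / 2 else m)" for b
    have ss: "sets (step \<mu> L C \<rho>) = sets (count_space UNIV \<Otimes>\<^sub>M borel)"
      using measurable_space[OF measurable_step[OF haar], of \<rho> L C] by (simp add: space_prob_algebra)
    have "(\<integral>\<^sup>+w. weight (Suc t) w \<partial>k (bs, \<rho>)) =
       (\<integral>\<^sup>+w. weight (Suc t) ((\<lambda>(b, \<rho>'). (bs @ [b], \<rho>')) w) \<partial>step \<mu> L C \<rho>)"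
      unfolding k_def prod.case
      by (rule nn_integral_distr) (use app in \<open>simp_all cong: measurable_cong_sets add: ss measurable_weight\<close>)
    also have "\<dots> \<le> ennreal (g False - (g False - g True) * (Re (trace (hamiltonian L C ** \<rho>)) / L))"
    proof (rule nn_integral_step_le[OF haar L _ d])
      show "\<forall>\<alpha>\<in>{1..L}. valid_clause (C \<alpha>)" using no by (simp add: no_instance_def)
      show "(\<lambda>w. weight (Suc t) ((\<lambda>(b, \<rho>'). (bs @ [b], \<rho>')) w))
          \<in> borel_measurable (count_space UNIV \<Otimes>\<^sub>M (borel :: 'q op measure))"
        by (rule measurable_compose[OF app measurable_weight])
    qed (use m in \<open>auto simp: weight_def l g_def m_def\<close>)
    also have "\<dots> \<le> ennreal (r * m)"
    proof (rule ennreal_leI)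
      have "c \<le> Re (trace (hamiltonian L C ** \<rho>))" using no d by (simp add: no_instance_def)
      then have "m / 2 * (c / L) \<le> m / 2 * (Re (trace (hamiltonian L C ** \<rho>)) / L)"
        using m by (intro mult_left_mono divide_right_mono) auto
      \<comment> \<open>As \<open>g False - g True = m / 2\<close>, the energy bound gives the
        factor \<open>1 - c / (2 * L)\<close>, and \<open>1 + y \<le> exp y\<close> then gives
        \<open>r\<close>.\<close>
      then have "g False - (g False - g True) * (Re (trace (hamiltonian L C ** \<rho>)) / L) \<le> m * (1 + (- (c / (2 * L))))"
        by (simp add: g_def algebra_simps)
      also have "\<dots> \<le> m * r"
        unfolding r_def by (intro mult_left_mono exp_ge_add_one_self) (use m in auto)
      finally show "g False - (g False - g True) * (Re (trace (hamiltonian L C ** \<rho>)) / L) \<le> r * m"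
        by (simp add: mult.commute)
    qed
    also have "\<dots> = ennreal r * weight t (bs, \<rho>)"
      using r m by (simp add: weight_def d l m_def ennreal_mult)
    finally show ?thesis .
  qed
  have "(\<integral>\<^sup>+w. weight (Suc t) w \<partial>run \<mu> L C (Suc t)) = (\<integral>\<^sup>+x. (\<integral>\<^sup>+w. weight (Suc t) w \<partial>k x) \<partial>run \<mu> L C t)"
    unfolding run.simps k_def[symmetric] by (rule nn_integral_bind[OF measurable_weight k'])
  also have "\<dots> \<le> (\<integral>\<^sup>+x. ennreal r * weight t x \<partial>run \<mu> L C t)"
    by (intro nn_integral_mono) (use one in auto)
  also have "\<dots> = ennreal r * (\<integral>\<^sup>+x. weight t x \<partial>run \<mu> L C t)"
    by (intro nn_integral_cmult) (simp cong: measurable_cong_sets add: sr measurable_weight)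
  also have "\<dots> \<le> ennreal r * ennreal (r ^ t)"
    by (intro mult_left_mono) (use Suc in \<open>auto simp: r_def\<close>)
  also have "\<dots> = ennreal (r ^ Suc t)" using r by (simp add: ennreal_mult)
  finally show ?case by (simp add: r_def)
qed

section \<open>Tail bound for the number of zeros\<close>

lemma count_list_True_False: "count_list bs True + count_list bs False = length bs"
  by (induction bs) auto

text \<open>Markov's inequality: more than \<open>N\<close> zeros among \<open>t\<close> outcomes
  leave fewer than \<open>t - N\<close> ones, so on this event the weight is at least
  \<open>1 / a\<close> with \<open>a\<close> equal to 2 to the power \<open>t - N\<close>. As
  \<open>N\<close> is real, the power is written with \<open>exp\<close> and
  \<open>ln 2\<close>.\<close>

lemma run_few_ones:
  fixes C :: "nat \<Rightarrow> 'q::finite clause"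
  assumes haar: "haar_measure \<mu>" and L: "L \<ge> 1" and no: "no_instance L C c"
  shows "\<P>((bs, \<rho>) in run \<mu> L C t. real (count_list bs False) > N)
    \<le> exp (ln 2 * (real t - N) - c / (2 * L) * t)"
proof -
  let ?M = "run \<mu> L C t"
  let ?S = "{w \<in> space ?M. case w of (bs, \<rho>) \<Rightarrow> real (count_list bs False) > N}"
  define a where "a = exp (ln 2 * (real t - N))"
  have a: "a > 0" by (simp add: a_def)
  have sr: "sets ?M = sets (count_space UNIV \<Otimes>\<^sub>M borel)" and "prob_space ?M"
    using run_in_prob_algebra[OF haar, of L C t] by (simp_all add: space_prob_algebra)
  interpret prob_space ?M by fact
  have S [measurable]: "?S \<in> sets ?M"
    unfolding sr sets_eq_imp_space_eq[OF sr] by measurable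
  have ind: "indicator ?S w \<le> ennreal a * weight t w" for w
  proof (cases w)
    case [simp]: (Pair bs \<rho>)
    show ?thesis
    proof (cases "w \<in> ?S \<and> density_op \<rho> \<and> length bs = t")
      case True
      then have "real (count_list bs True) \<le> real t - N"
        using count_list_True_False[of bs] by auto
      then have "exp (ln 2 * count_list bs True) \<le> a" unfolding a_def by simp
      then have "1 \<le> a * (1/2) ^ count_list bs True"
        by (simp add: exp_of_nat2_mult mult.commute[of "ln 2"] exp_of_nat_mult power_one_over field_simps)
      then show ?thesis using True a by (simp add: weight_def ennreal_mult[symmetric] ennreal_1[symmetric] del: ennreal_1)
    next
      \<comment> \<open>Either the indicator vanishes, or the weight is \<top> and
        \<open>a > 0\<close>.\<close>
      case False
      then show ?thesis using a by (auto simp: weight_def ennreal_mult_top indicator_def)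
    qed
  qed
  have "emeasure ?M ?S = (\<integral>\<^sup>+w. indicator ?S w \<partial>?M)" by simp
  also have "\<dots> \<le> (\<integral>\<^sup>+w. ennreal a * weight t w \<partial>?M)" by (intro nn_integral_mono ind)
  also have "\<dots> = ennreal a * (\<integral>\<^sup>+w. weight t w \<partial>?M)"
    by (intro nn_integral_cmult) (simp cong: measurable_cong_sets add: sr measurable_weight)
  also have "\<dots> \<le> ennreal a * ennreal (exp (- (c / (2 * L))) ^ t)"
    by (intro mult_left_mono nn_integral_run_weight assms) auto
  also have "\<dots> = ennreal (a * exp (- (c / (2 * L))) ^ t)" using a by (simp add: ennreal_mult)
  also have "a * exp (- (c / (2 * L))) ^ t = exp (ln 2 * (real t - N) - c / (2 * L) * t)"
    by (simp add: a_def exp_of_nat_mult[symmetric] exp_add[symmetric] mult.commute)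
  finally have "prob ?S \<le> exp (ln 2 * (real t - N) - c / (2 * L) * t)"
    unfolding emeasure_eq_measure by (simp only: ennreal_le_iff exp_ge_zero)
  moreover have "?S = {(bs, \<rho>). (bs, \<rho>) \<in> space ?M \<and> real (count_list bs False) > N}" by auto
  ultimately show ?thesis by (simp only:)
qed

section \<open>Numerical estimates for the given parameters\<close>

theorem mainTheorem2:
  fixes \<mu> :: "(complex ^ bool ^ bool) measure"
    and C :: "nat \<Rightarrow> 'q::finite clause"
    and n L T :: nat
    and c f N :: real
  assumes "haar_measure \<mu>"
    and "n = CARD('q)" and "n \<ge> 2" and "L \<ge> 1" and "c > 0"
    and "no_instance L C c"
    and "f = max (7 / c) 1"
    and "real T = f\<^sup>2 * (real L)\<^sup>2 * (real n)\<^sup>2 / 2"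
    and "N = real T * ((f * real L - 1) / (f * real L)) ^ 3 - f * real L * real n"
  shows "\<P>((bs, \<rho>) in run \<mu> L C T. real (count_list bs False) > N) \<le> 1 / 3"
proof -
  \<comment> \<open>In these variables \<open>T = x * m / 2\<close>, and both terms of the exponent
    in \<open>run_few_ones\<close> are compared with multiples of \<open>m\<close>.\<close>
  define x where "x = f * real L"
  define m where "m = x * (real n)\<^sup>2"
  have f: "f \<ge> 1" "c * f \<ge> 7"
    using assms(5,7) by (auto simp: max_def field_simps)
  have x: "x \<ge> 1" unfolding x_def using f assms(4) by (metis mult_mono' mult_1 of_nat_1 of_nat_mono zero_le_one)
  have T: "real T = x * m / 2" by (simp add: assms(8) x_def m_def power2_eq_square)
  have n2: "2 * real n \<le> (real n)\<^sup>2" using assms(3) by (simp add: power2_eq_square)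
  have m: "m \<ge> 4"
  proof -
    have "1 * 2\<^sup>2 \<le> x * (real n)\<^sup>2" using x assms(3) by (intro mult_mono power_mono) auto
    then show ?thesis by (simp add: m_def)
  qed
  have TN: "real T - N \<le> 2 * m"
  proof -
    \<comment> \<open>Bernoulli's inequality applies since \<open>x \<ge> 1\<close>. The cube then
      costs at most \<open>T * 3 / x = 3 / 2 * m\<close>, and \<open>n \<ge> 2\<close> bounds the
      remaining term \<open>x * n\<close> by \<open>m / 2\<close>, which together give
      \<open>2 * m\<close>.\<close>
    have "1 + 3 * (- (1 / x)) \<le> (1 + (- (1 / x))) ^ 3"
      using Bernoulli_inequality[of "- (1 / x)" 3] x by simp
    also have "1 + (- (1 / x)) = (x - 1) / x" using x by (simp add: field_simps)
    finally have "real T * (1 - 3 / x) \<le> real T * ((x - 1) / x) ^ 3"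
      by (intro mult_left_mono) auto
    moreover have "real T * (1 - 3 / x) = real T - 3 / 2 * m" using x by (simp add: T field_simps)
    moreover have "x * real n \<le> m / 2" using mult_left_mono[OF n2, of x] x by (simp add: m_def)
    ultimately show ?thesis by (simp add: assms(9) x_def[symmetric])
  qed
  \<comment> \<open>The left side of \<open>c * f \<ge> 7\<close> appears because
    \<open>T / L = f * m / 2\<close>.\<close>
  have cT: "7 / 4 * m \<le> c / (2 * L) * T"
  proof -
    have "c / (2 * L) * T = c * f * m / 4" using assms(4) by (simp add: T x_def field_simps)
    then show ?thesis using mult_right_mono[OF f(2), of m] m by simp
  qed
  have ln2: "ln 2 \<le> (25/36 :: real)" by (rule ln2_le_25_over_36)
  have "ln 2 * (real T - N) \<le> 25/36 * (2 * m)"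
    by (rule order_trans[OF mult_left_mono[OF TN] mult_right_mono[OF ln2]]) (use m in auto)
  \<comment> \<open>The exponent is at most \<open>(25/18 - 7/4) * m = - 13/36 * m\<close>, and
    \<open>m \<ge> 4\<close> makes this at most \<open>- 13/9\<close>.\<close>
  then have "ln 2 * (real T - N) - c / (2 * L) * T \<le> - (13/9)" using cT m by linarith
  then have "exp (ln 2 * (real T - N) - c / (2 * L) * T) \<le> exp (- (13/9))" by simp
  \<comment> \<open>The quadratic Taylor bound suffices: \<open>1 + y + y^2 / 2\<close> exceeds 3 at
    \<open>y = 13/9\<close>.\<close>
  also have "\<dots> \<le> 1 / 3"
    using exp_lower_Taylor_quadratic[of "13/9 :: real"]
    by (simp add: exp_minus field_simps power2_eq_square)
  finally show ?thesis using run_few_ones[OF assms(1,4,6), of T N] by linarith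
qed

end
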